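(* Let $h:\mathbb{C}\to\mathbb{C}$ be a homeomorphism (of the plane onto itself). Then there exists a non-constant complex polynomial $P$ in one complex variable such that $P\circ h$ is not a Lipschitz quotient mapping.
   Context: For metric spaces $X,Y$, $B^Z_s(z)$ denotes the open ball of radius $s>0$ centred at $z\in Z$, $Z=X,Y$. A mapping $f:X\to Y$ is a Lipschitz quotient mapping if there exist constants $0<c\le L<+\infty$ such that for every $x\in X$ and every $r>0$, $B^Y_{cr}(f(x))\subseteq f(B^X_r(x))\subseteq B^Y_{Lr}(f(x))$. The plane $\mathbb{C}$ is identified with $\mathbb{R}^2$; no particular norm is specified on the domain or codomain, since passing to equivalent norms does not affect whether a mapping is a Lipschitz quotient mapping (so one may use the Euclidean norm $|\cdot|$). *)

theory Defs
  imports "HOL-Analysis.Analysis" "HOL-Computational_Algebra.Polynomial"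
begin

definition lipschitz_quotient_map :: "('a::metric_space \<Rightarrow> 'b::metric_space) \<Rightarrow> bool" where
  "lipschitz_quotient_map f \<longleftrightarrow>
    (\<exists>c L::real. 0 < c \<and> c \<le> L \<and>
      (\<forall>x r. r > 0 \<longrightarrow>
        ball (f x) (c * r) \<subseteq> f ` ball x r \<and> f ` ball x r \<subseteq> ball (f x) (L * r)))"

end

theory Submission
  imports Defs
begin

text \<open>
  The linear polynomial \<open>z\<close> and the quadratic polynomial \<open>z\<^sup>2\<close> cannot both work. If \<open>h\<close> itself
  is a Lipschitz quotient mapping then, being bijective, it has a Lipschitz inverse, so points
  of the codomain at unit distance have preimages at uniformly bounded distance. Were \<open>z\<^sup>2 \<circ> h\<close>
  Lipschitz as well, then \<open>z\<^sup>2 = (z\<^sup>2 \<circ> h) \<circ> h\<^sup>-\<^sup>1\<close> would be Lipschitz on the whole plane, whereas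
  \<open>(u + 1)\<^sup>2 - u\<^sup>2 = 2 u + 1\<close> is unbounded in \<open>u\<close>.
\<close>

lemma lipschitz_quotient_mapE:
  assumes "lipschitz_quotient_map f"
  obtains c L where "0 < c" "0 < L"
    "\<And>x r. r > 0 \<Longrightarrow> ball (f x) (c * r) \<subseteq> f ` ball x r"
    "\<And>x r. r > 0 \<Longrightarrow> f ` ball x r \<subseteq> ball (f x) (L * r)"
proof -
  from assms obtain c L where "0 < c" "c \<le> L"
    "\<forall>x r. r > 0 \<longrightarrow> ball (f x) (c * r) \<subseteq> f ` ball x r \<and> f ` ball x r \<subseteq> ball (f x) (L * r)"
    unfolding lipschitz_quotient_map_def by blast
  then show thesis
    by (intro that[of c L]) auto
qed

text \<open>
  Transporting balls back along the Lipschitz inverse of \<open>h\<close> bounds the oscillation of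
  \<open>g\<close> on unit balls of the codomain of \<open>h\<close> uniformly in the centre.
\<close>

lemma lipschitz_quotient_bij_comp_bounded:
  assumes "bij h" "lipschitz_quotient_map h" "lipschitz_quotient_map (g \<circ> h)"
  obtains K where "K > 0" "\<And>u w. dist u w \<le> 1 \<Longrightarrow> dist (g u) (g w) < K"
proof -
  obtain c where c: "0 < c" "\<And>x r. r > 0 \<Longrightarrow> ball (h x) (c * r) \<subseteq> h ` ball x r"
    using assms(2) by (rule lipschitz_quotient_mapE) blast
  obtain L where L: "0 < L"
    "\<And>x r. r > 0 \<Longrightarrow> (g \<circ> h) ` ball x r \<subseteq> ball ((g \<circ> h) x) (L * r)"
    using assms(3) by (rule lipschitz_quotient_mapE) blast
  \<comment> \<open>Balls are open, so reaching points at distance exactly 1 requires \<open>c * r > 1\<close>.\<close>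
  define r where "r = 2 / c"
  have r: "r > 0" "c * r = 2"
    using c(1) by (auto simp: r_def)
  have "dist (g u) (g w) < L * r" if "dist u w \<le> 1" for u w
  proof -
    obtain x where x: "u = h x"
      using assms(1) by (meson bij_pointE)
    have "w \<in> ball (h x) (c * r)"
      using that r x by simp
    then obtain y where y: "y \<in> ball x r" "w = h y"
      using c(2)[OF r(1)] by blast
    then have "(g \<circ> h) y \<in> ball ((g \<circ> h) x) (L * r)"
      using L(2)[OF r(1), of x] by blast
    then show ?thesis
      using x y by simp
  qed
  then show thesis
    using L(1) r(1) by (intro that[of "L * r"]) auto
qed

theorem lemma2p30:
  fixes h k :: "complex \<Rightarrow> complex"
  assumes "homeomorphism UNIV UNIV h k"
  shows "\<exists>P :: complex poly. degree P > 0 \<and> \<not> lipschitz_quotient_map (poly P \<circ> h)"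
proof (cases "lipschitz_quotient_map h")
  case False
  have "poly [:0, 1:] \<circ> h = h"
    by (simp add: fun_eq_iff)
  with False show ?thesis
    by (intro exI[of _ "[:0, 1:]"]) simp
next
  case True
  have "bij h"
    using assms unfolding homeomorphism_def by (intro o_bij[of k]) auto
  let ?Q = "[:0, 0, 1:] :: complex poly"
  have "\<not> lipschitz_quotient_map (poly ?Q \<circ> h)"
  proof
    assume "lipschitz_quotient_map (poly ?Q \<circ> h)"
    with \<open>bij h\<close> True obtain K where K: "K > 0"
      "\<And>u w. dist u w \<le> 1 \<Longrightarrow> dist (poly ?Q u) (poly ?Q w) < K"
      by (rule lipschitz_quotient_bij_comp_bounded) blast
    let ?u = "complex_of_real K"
    have "dist (poly ?Q (?u + 1)) (poly ?Q ?u) = norm (complex_of_real (2 * K + 1))"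
      by (simp add: dist_norm algebra_simps)
    also have "\<dots> = 2 * K + 1"
      using K(1) by (simp only: norm_of_real)
    finally show False
      using K(1) K(2)[of "?u + 1" ?u] by (simp add: dist_norm)
  qed
  then show ?thesis
    by (intro exI[of _ ?Q]) simp
qed

end
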